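(* Let $k,\ell\ge1$. A function $f:\mathbb{N}^k\to\mathbb{N}^\ell$ can be computed by a finite abelian processor if and only if all of the following hold: (i) $f(\mathbf{0})=\mathbf{0}$; (ii) $f$ is increasing; (iii) $f=L+P$ for a linear function $L:\mathbb{N}^k\to\mathbb{Q}^\ell$ and an eventually periodic function $P:\mathbb{N}^k\to\mathbb{Q}^\ell$.
   Context: $\mathbb{N}=\{0,1,2,\dots\}$. A processor with finite input alphabet $A$, finite output alphabet $B$ and finite state space $Q$ consists of transition maps $t_i:Q\to Q$ and output maps $o_i:Q\to\mathbb{N}^B$ ($i\in A$): on receiving letter $i$ in state $q$ it moves to $t_i(q)$ and emits $(o_i(q))_b$ copies of letter $b$. It is abelian if $t_it_j=t_jt_i$ and $o_i+o_j\circ t_i=o_j+o_i\circ t_j$ for all $i,j\in A$. Every processor has an initial state $q^0$ from which every state is reachable by compositions of transition maps. It computes $F:\mathbb{N}^A\to\mathbb{N}^B$, where $F(\mathbf{x})$ is the total output when, from $q^0$, it receives $x_a$ letters $a$ for each $a$ (order-independent); here $|A|=k$, $|B|=\ell$. $f$ is increasing if $\mathbf{x}\le\mathbf{y}$ coordinatewise implies $f(\mathbf{x})\le f(\mathbf{y})$. $P$ is eventually periodic if there exist integers $\lambda_1,\dots,\lambda_k\ge1$ and $r_1,\dots,r_k$ such that $P(\mathbf{x})=P(\mathbf{x}+\lambda_i\mathbf{e}_i)$ for all $i$ and all $\mathbf{x}\in\mathbb{N}^k$ with $x_i\ge r_i$, where $\mathbf{e}_i$ is the $i$th standard basis vector.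 *)

theory Defs
  imports "HOL-Analysis.Analysis"
begin

record ('q, 'a, 'b::finite) processor =
  states :: "'q set"
  initial :: "'q"
  transition :: "'a \<Rightarrow> 'q \<Rightarrow> 'q"
  emission :: "'a \<Rightarrow> 'q \<Rightarrow> nat ^ 'b"

primrec run :: "('q, 'a, 'b::finite) processor \<Rightarrow> 'q \<Rightarrow> 'a list \<Rightarrow> 'q" where
  "run p q [] = q"
| "run p q (i # w) = run p (transition p i q) w"

primrec total_output :: "('q, 'a, 'b::finite) processor \<Rightarrow> 'q \<Rightarrow> 'a list \<Rightarrow> nat ^ 'b" where
  "total_output p q [] = 0"
| "total_output p q (i # w) = emission p i q + total_output p (transition p i q) w"

definition finite_processor :: "('q, 'a, 'b::finite) processor \<Rightarrow> bool" where
  "finite_processor p \<longleftrightarrow>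
     finite (states p) \<and> initial p \<in> states p \<and>
     (\<forall>i. \<forall>q\<in>states p. transition p i q \<in> states p) \<and>
     (\<forall>q\<in>states p. \<exists>w. run p (initial p) w = q)"

definition abelian :: "('q, 'a, 'b::finite) processor \<Rightarrow> bool" where
  "abelian p \<longleftrightarrow> (\<forall>i j. \<forall>q\<in>states p.
     transition p i (transition p j q) = transition p j (transition p i q) \<and>
     emission p i q + emission p j (transition p i q)
       = emission p j q + emission p i (transition p j q))"

text \<open>\<open>F x\<close> is the total output on any word having \<open>x $ a\<close> letters \<open>a\<close> for each \<open>a\<close>.
  Quantifying over all such words keeps the definition independent of a choice of order.\<close>

definition letter_counts :: "'a list \<Rightarrow> nat ^ ('a::finite)" where
  "letter_counts w = (\<chi> a. count_list w a)"

definition computes ::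
    "('q, 'a::finite, 'b::finite) processor \<Rightarrow> (nat ^ 'a \<Rightarrow> nat ^ 'b) \<Rightarrow> bool" where
  "computes p F \<longleftrightarrow> (\<forall>w. total_output p (initial p) w = F (letter_counts w))"

text \<open>HOL cannot quantify existentially over the type of states, so the state space is taken
  to be a finite set of natural numbers. Lemma \<open>computable_if_computes\<close> below shows that no
  processor, over any type of states, is lost.\<close>

definition computable_by_finite_abelian_processor ::
    "(nat ^ 'a::finite \<Rightarrow> nat ^ 'b::finite) \<Rightarrow> bool" where
  "computable_by_finite_abelian_processor F \<longleftrightarrow>
     (\<exists>p :: (nat, 'a, 'b) processor. finite_processor p \<and> abelian p \<and> computes p F)"

lemma computable_if_computes:
  fixes p :: "('q, 'a::finite, 'b::finite) processor"
  assumes fin: "finite_processor p" and ab: "abelian p" and comp: "computes p F"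
  shows "computable_by_finite_abelian_processor F"
proof -
  from fin have "finite (states p)"
    by (simp add: finite_processor_def)
  then obtain e :: "'q \<Rightarrow> nat" where inj: "inj_on e (states p)"
    using finite_imp_inj_to_nat_seg by blast
  define d where "d = inv_into (states p) e"
  define p' :: "(nat, 'a, 'b) processor" where
    "p' = \<lparr>states = e ` states p, initial = e (initial p),
           transition = (\<lambda>i n. e (transition p i (d n))),
           emission = (\<lambda>i n. emission p i (d n))\<rparr>"
  have d: "d (e q) = q" if "q \<in> states p" for q
    using that inj by (simp add: d_def)
  have closed: "transition p i q \<in> states p" if "q \<in> states p" for i q
    using that fin by (simp add: finite_processor_def)
  have init: "initial p \<in> states p"
    using fin by (simp add: finite_processor_def)
  have run: "run p' (e q) w = e (run p q w)" if "q \<in> states p" for q w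
    using that by (induction w arbitrary: q) (simp_all add: p'_def d closed)
  have out: "total_output p' (e q) w = total_output p q w" if "q \<in> states p" for q w
    using that by (induction w arbitrary: q) (simp_all add: p'_def d closed)
  have sel: "states p' = e ` states p" "initial p' = e (initial p)"
    by (simp_all add: p'_def)
  have "\<exists>w. run p' (initial p') w = n" if "n \<in> states p'" for n
  proof -
    from that obtain q where q: "q \<in> states p" "n = e q"
      by (auto simp: sel)
    with fin obtain w where "run p (initial p) w = q"
      by (auto simp: finite_processor_def)
    with q run[OF init] show ?thesis
      by (auto simp: sel)
  qed
  moreover have "finite (states p')" "initial p' \<in> states p'"
    using fin by (auto simp: sel finite_processor_def)
  moreover have "transition p' i n \<in> states p'" if "n \<in> states p'" for i n
    using that by (auto simp: p'_def d closed)
  ultimately have "finite_processor p'"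
    by (simp add: finite_processor_def)
  moreover have "abelian p'"
    using ab by (auto simp: abelian_def p'_def d closed)
  moreover have "computes p' F"
    using comp out[OF init] by (simp add: computes_def sel)
  ultimately show ?thesis
    by (auto simp: computable_by_finite_abelian_processor_def)
qed

definition rat_vec :: "nat ^ 'n \<Rightarrow> rat ^ 'n" where
  "rat_vec x = (\<chi> i. of_nat (x $ i))"

text \<open>A function on \<open>\<nat>\<^sup>k\<close> is linear if it is the restriction of a \<open>\<rat>\<close>-linear map on \<open>\<rat>\<^sup>k\<close>.\<close>

definition linear_on_nat :: "(nat ^ 'a \<Rightarrow> rat ^ 'b) \<Rightarrow> bool" where
  "linear_on_nat L \<longleftrightarrow>
     (\<exists>M :: rat ^ 'a \<Rightarrow> rat ^ 'b. Vector_Spaces.linear (*s) (*s) M \<and> (\<forall>x. L x = M (rat_vec x)))"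

definition eventually_periodic :: "(nat ^ 'a \<Rightarrow> 'c) \<Rightarrow> bool" where
  "eventually_periodic P \<longleftrightarrow>
     (\<exists>(l :: 'a \<Rightarrow> nat) (r :: 'a \<Rightarrow> int). (\<forall>i. l i \<ge> 1) \<and>
        (\<forall>i x. int (x $ i) \<ge> r i \<longrightarrow> P x = P (x + axis i (l i))))"

end

theory Submission imports Defs begin

text \<open>Myhill--Nerode for abelian processors. The behaviour of a processor that has received \<open>x\<close>
  is the residual \<open>y \<mapsto> f (x + y) - f x\<close>, so \<open>f\<close> is computable iff \<open>f 0 = 0\<close>, \<open>f\<close> is increasing
  and \<open>f\<close> has finitely many residuals. If \<open>f = L + P\<close>, then translating \<open>x\<close> by a period of \<open>P\<close> does
  not change the residual. Conversely, by the pigeonhole principle finitely many residuals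
  admit a period \<open>\<lambda>\<^sub>i\<close> in every direction; the increment \<open>f (x + \<lambda>\<^sub>i e\<^sub>i) - f x\<close> is then a constant
  \<open>c\<^sub>i\<close> for all \<open>x\<close> far enough in direction \<open>i\<close>, and \<open>L\<close> is the linear function with slopes
  \<open>c\<^sub>i / \<lambda>\<^sub>i\<close>.\<close>

section \<open>Runs and letter counts of words\<close>

lemma total_output_append:
  "total_output p q (v @ w) = total_output p q v + total_output p (run p q v) w"
  by (induction v arbitrary: q) (simp_all add: add.assoc)

lemma run_in_states: "finite_processor p \<Longrightarrow> q \<in> states p \<Longrightarrow> run p q w \<in> states p"
  by (induction w arbitrary: q) (simp_all add: finite_processor_def)

lemma letter_counts_Nil [simp]: "letter_counts [] = 0"
  by (simp add: letter_counts_def vec_eq_iff)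

lemma letter_counts_Cons: "letter_counts (i # w) = axis i 1 + letter_counts w"
  by (simp add: letter_counts_def vec_eq_iff axis_def)

lemma letter_counts_append: "letter_counts (v @ w) = letter_counts v + letter_counts w"
  by (simp add: letter_counts_def vec_eq_iff)

text \<open>\<open>computes\<close> constrains a function only at letter counts; these turn out to
  be all arguments.\<close>

lemma surj_letter_counts: "\<exists>w. letter_counts w = x"
proof (induction "\<Sum>i\<in>UNIV. x $ i" arbitrary: x rule: less_induct)
  case less
  show ?case
  proof (cases "x = 0")
    case True
    then show ?thesis
      using letter_counts_Nil by blast
  next
    case False
    then obtain i where i: "x $ i > 0"
      by (auto simp: vec_eq_iff)
    have "(\<Sum>j\<in>UNIV. (x - axis i 1) $ j) < (\<Sum>j\<in>UNIV. x $ j)"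
      by (rule sum_strict_mono_ex1) (use i in \<open>auto simp: axis_def intro!: exI[of _ i]\<close>)
    from less[OF this] obtain w where w: "letter_counts w = x - axis i 1"
      by blast
    have "letter_counts (i # w) = x"
      using i by (auto simp: letter_counts_Cons w vec_eq_iff axis_def)
    then show ?thesis by blast
  qed
qed

section \<open>Coordinatewise order and finite boxes\<close>

lemma nat_vec_le_add: "(x :: nat ^ 'n) \<le> x + y"
  by (simp add: less_eq_vec_def)

lemma nat_vec_le_addD:
  assumes "(x :: nat ^ 'n) \<le> y"
  obtains z where "y = x + z"
proof
  show "y = x + (y - x)"
    using assms by (simp add: less_eq_vec_def vec_eq_iff)
qed

lemma finite_nat_vec_box: "finite {x :: nat ^ 'n. \<forall>i. x $ i < N i}"
proof -
  have "(\<lambda>x. vec_nth x) ` {x :: nat ^ 'n. \<forall>i. x $ i < N i} \<subseteq> PiE UNIV (\<lambda>i. {..<N i})"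
    by auto
  then have "finite ((\<lambda>x. vec_nth x) ` {x :: nat ^ 'n. \<forall>i. x $ i < N i})"
    by (rule finite_subset) (simp add: finite_PiE)
  then show ?thesis
    by (rule finite_imageD) (auto simp: inj_on_def vec_nth_inject)
qed

section \<open>Residuals of increasing functions\<close>

definition residual :: "(nat ^ 'a \<Rightarrow> nat ^ 'b) \<Rightarrow> nat ^ 'a \<Rightarrow> nat ^ 'a \<Rightarrow> nat ^ 'b" where
  "residual f x = (\<lambda>y. f (x + y) - f x)"

text \<open>Monotonicity makes the truncated subtraction in \<open>residual\<close> exact.\<close>

lemma residual_add:
  assumes "mono f"
  shows "f (x + y) = f x + residual f x y"
proof -
  have "f x \<le> f (x + y)"
    by (rule monoD[OF assms nat_vec_le_add])
  then show ?thesis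
    by (simp add: residual_def less_eq_vec_def vec_eq_iff)
qed

text \<open>Translation thus acts on the residuals of \<open>f\<close>:
  \<open>residual f (x + y)\<close> depends on \<open>x\<close> only through
  \<open>residual f x\<close>. This action supplies the transitions of the canonical processor and
  the self-maps for the pigeonhole argument.\<close>

lemma residual_residual:
  assumes "mono f"
  shows "residual (residual f x) y = residual f (x + y)"
proof
  fix z
  have "f (x + y) \<le> f (x + y + z)" "f x \<le> f (x + y)"
    by (rule monoD[OF assms nat_vec_le_add])+
  then show "residual (residual f x) y z = residual f (x + y) z"
    by (simp add: residual_def less_eq_vec_def vec_eq_iff add.assoc)
qed

text \<open>The criterion contains no subtraction, so it can be checked after embedding into the
  rationals.\<close>

lemma residual_eqI:
  assumes f: "mono f" and eq: "\<And>z. f (x + z) + f y = f (y + z) + f x"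
  shows "residual f x = residual f y"
proof
  fix z
  show "residual f x z = residual f y z"
    using eq[of z] unfolding residual_add[OF f, of x] residual_add[OF f, of y]
    by (simp add: vec_eq_iff)
qed

section \<open>Computability and finiteness of residuals\<close>

lemma computable_imp_finite_residuals:
  fixes f :: "nat ^ 'a \<Rightarrow> nat ^ 'b"
  assumes "computable_by_finite_abelian_processor f"
  shows "f 0 = 0 \<and> mono f \<and> finite (range (residual f))"
proof -
  from assms obtain p :: "(nat, 'a, 'b) processor"
    where p: "finite_processor p" and comp: "computes p f"
    by (auto simp: computable_by_finite_abelian_processor_def)
  define q where "q = initial p"
  have f: "f (letter_counts w) = total_output p q w" for w
    using comp by (simp add: computes_def q_def)
  have f_add: "f (letter_counts v + letter_counts w)
      = f (letter_counts v) + total_output p (run p q v) w" for v w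
    unfolding letter_counts_append[symmetric] f by (simp add: total_output_append)
  have f0: "f 0 = 0"
    using f[of "[]"] by simp
  have mono: "mono f"
  proof (rule monoI)
    fix x y :: "nat ^ 'a"
    assume "x \<le> y"
    then obtain z where y: "y = x + z"
      by (rule nat_vec_le_addD)
    obtain v w where "letter_counts v = x" "letter_counts w = z"
      using surj_letter_counts by blast
    then show "f x \<le> f y"
      using f_add[of v w] y by (simp add: nat_vec_le_add)
  qed
  obtain word :: "nat ^ 'a \<Rightarrow> 'a list" where word: "letter_counts (word x) = x" for x
    using surj_letter_counts by metis
  \<comment> \<open>The residual at \<open>x\<close> is the output behaviour of the state reached
    after \<open>x\<close>, so there are at most as many residuals as states.\<close>
  have "residual f x = (\<lambda>s y. total_output p s (word y)) (run p q (word x))" for x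
  proof
    fix y
    show "residual f x y = (\<lambda>s y. total_output p s (word y)) (run p q (word x)) y"
      using f_add[of "word x" "word y"] by (simp add: word residual_def vec_eq_iff)
  qed
  moreover have "run p q (word x) \<in> states p" for x
    using p by (intro run_in_states) (simp_all add: q_def finite_processor_def)
  ultimately have "range (residual f) \<subseteq> (\<lambda>s y. total_output p s (word y)) ` states p"
    by blast
  moreover have "finite (states p)"
    using p by (simp add: finite_processor_def)
  ultimately have "finite (range (residual f))"
    by (meson finite_imageI finite_subset)
  with f0 mono show ?thesis by blast
qed

lemma finite_residuals_imp_computable:
  fixes f :: "nat ^ 'a \<Rightarrow> nat ^ 'b"
  assumes f0: "f 0 = 0" and mono: "mono f" and fin: "finite (range (residual f))"
  shows "computable_by_finite_abelian_processor f"
proof -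
  \<comment> \<open>The canonical processor: its states are the residuals, and a letter translates
    the residual by a unit vector and emits the residual's value there.\<close>
  define p :: "(nat ^ 'a \<Rightarrow> nat ^ 'b, 'a, 'b) processor" where
    "p = \<lparr>states = range (residual f), initial = residual f 0,
          transition = (\<lambda>i g. residual g (axis i 1)), emission = (\<lambda>i g. g (axis i 1))\<rparr>"
  have sel: "states p = range (residual f)" "initial p = residual f 0"
      "transition p i (residual f x) = residual f (x + axis i 1)"
      "emission p i (residual f x) = residual f x (axis i 1)" for i x
    by (simp_all add: p_def residual_residual[OF mono])
  have run: "run p (residual f x) w = residual f (x + letter_counts w)" for x w
    by (induction w arbitrary: x) (simp_all add: sel letter_counts_Cons add.assoc)
  \<comment> \<open>\<open>f x\<close> stands for the output emitted so far; the case
    \<open>x = 0\<close> gives \<open>computes\<close>, because \<open>f 0 = 0\<close>.\<close>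
  have out: "f x + total_output p (residual f x) w = f (x + letter_counts w)" for x w
  proof (induction w arbitrary: x)
    case (Cons i w)
    have "f x + total_output p (residual f x) (i # w)
        = f (x + axis i 1) + total_output p (residual f (x + axis i 1)) w"
      using residual_add[OF mono, of x "axis i 1"] by (simp add: sel add.assoc)
    also have "\<dots> = f (x + letter_counts (i # w))"
      by (simp only: Cons letter_counts_Cons add.assoc)
    finally show ?case .
  qed simp
  have "\<exists>w. run p (initial p) w = residual f x" for x
    using surj_letter_counts[of x] by (auto simp: sel(2) run)
  then have "finite_processor p"
    using fin by (auto simp: finite_processor_def sel)
  moreover have "abelian p"
  proof -
    \<comment> \<open>The joint output of two letters is an expression symmetric in \<open>i\<close>
      and \<open>j\<close>.\<close>
    have "residual f x (axis i 1) + residual f (x + axis i 1) (axis j 1)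
        = residual f x (axis i 1 + axis j 1)" for x i j
    proof -
      have "f x + (residual f x (axis i 1) + residual f (x + axis i 1) (axis j 1))
          = f x + residual f x (axis i 1 + axis j 1)"
        by (simp flip: residual_add[OF mono] add.assoc)
      then show ?thesis by (simp add: vec_eq_iff)
    qed
    then show ?thesis
      by (auto simp: abelian_def sel ac_simps)
  qed
  moreover have "computes p f"
    using out[of 0] by (simp add: computes_def sel(2) f0)
  ultimately show ?thesis
    by (rule computable_if_computes)
qed

section \<open>Linear plus eventually periodic functions\<close>

lemma rat_vec_add: "rat_vec (x + y) = rat_vec x + rat_vec y"
  by (simp add: rat_vec_def vec_eq_iff)

lemma rat_vec_eq_iff: "rat_vec x = rat_vec y \<longleftrightarrow> x = y"
  by (simp add: rat_vec_def vec_eq_iff)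

lemma linear_on_nat_add:
  assumes "linear_on_nat L"
  shows "L (x + y) = L x + L y"
proof -
  from assms obtain M where M: "Vector_Spaces.linear (*s) (*s) M" "\<And>x. L x = M (rat_vec x)"
    by (auto simp: linear_on_nat_def)
  show ?thesis
    using Vector_Spaces.linear.axioms(3)[OF M(1)]
    by (simp add: M(2) rat_vec_add module_hom.add module_hom_iff)
qed

lemma linear_plus_periodic_imp_finite_residuals:
  fixes f :: "nat ^ 'a \<Rightarrow> nat ^ 'b"
  assumes mono: "mono f" and L: "linear_on_nat L" and P: "eventually_periodic P"
    and f: "\<And>x. rat_vec (f x) = L x + P x"
  shows "finite (range (residual f))"
proof -
  from P obtain l :: "'a \<Rightarrow> nat" and r :: "'a \<Rightarrow> int" where l: "\<And>i. l i \<ge> 1"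
    and per: "\<And>i x. int (x $ i) \<ge> r i \<Longrightarrow> P x = P (x + axis i (l i))"
    unfolding eventually_periodic_def by blast
  \<comment> \<open>The period leaves \<open>P\<close> unchanged at \<open>x\<close> and at
    \<open>x + z\<close>, while \<open>L\<close> grows by the same amount at both.\<close>
  have shift: "residual f (x + axis i (l i)) = residual f x" if "int (x $ i) \<ge> r i" for i x
  proof (rule residual_eqI[OF mono])
    fix z
    have "P (x + z + axis i (l i)) = P (x + z)" "P (x + axis i (l i)) = P x"
      using per[of i "x + z"] per[of i x] that by simp_all
    then have "rat_vec (f (x + axis i (l i) + z) + f x) = rat_vec (f (x + z) + f (x + axis i (l i)))"
      by (simp add: rat_vec_add f linear_on_nat_add[OF L] ac_simps)
    then show "f (x + axis i (l i) + z) + f x = f (x + z) + f (x + axis i (l i))"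
      by (simp only: rat_vec_eq_iff)
  qed
  \<comment> \<open>If \<open>x $ i \<ge> N i\<close>, subtracting \<open>l i\<close> still leaves a
    coordinate of at least \<open>r i\<close>, where \<open>shift\<close> applies; so every residual
    occurs inside the box.\<close>
  define N where "N = (\<lambda>i. nat (r i) + l i)"
  have "residual f x \<in> residual f ` {x. \<forall>i. x $ i < N i}" for x
  proof (induction "\<Sum>i\<in>UNIV. x $ i" arbitrary: x rule: less_induct)
    case less
    show ?case
    proof (cases "\<forall>i. x $ i < N i")
      case False
      then obtain i where i: "x $ i \<ge> N i"
        by (auto simp: not_less)
      define y where "y = x - axis i (l i)"
      have x: "x = y + axis i (l i)"
        using i by (auto simp: y_def vec_eq_iff axis_def N_def)
      have "(\<Sum>j\<in>UNIV. y $ j) < (\<Sum>j\<in>UNIV. x $ j)"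
        by (rule sum_strict_mono_ex1) (use l[of i] in \<open>auto simp: x axis_def intro!: exI[of _ i]\<close>)
      then have "residual f y \<in> residual f ` {x. \<forall>i. x $ i < N i}"
        by (rule less)
      moreover have "int (y $ i) \<ge> r i"
        using i by (simp add: y_def axis_def N_def)
      ultimately show ?thesis
        by (simp add: x shift)
    qed blast
  qed
  then have "range (residual f) \<subseteq> residual f ` {x. \<forall>i. x $ i < N i}"
    by blast
  then show ?thesis
    by (rule finite_subset) (simp add: finite_nat_vec_box)
qed

lemma finite_residuals_imp_linear_plus_periodic:
  fixes f :: "nat ^ 'a \<Rightarrow> nat ^ 'b"
  assumes mono: "mono f" and fin: "finite (range (residual f))"
  obtains L P where "linear_on_nat L" "eventually_periodic P" "\<And>x. rat_vec (f x) = L x + P x"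
proof -
  let ?R = "range (residual f)"
  have "\<exists>r l. l \<ge> 1 \<and> (\<forall>x. residual f (x + axis i (r + l)) = residual f (x + axis i r))"
    for i :: 'a
  proof -
    \<comment> \<open>\<open>S n\<close> is translation by \<open>n\<close> in direction
      \<open>i\<close>, as a self-map of the finite set of residuals. A coincidence
      \<open>S m = S n\<close> holds on all residuals at once, so threshold and period do not depend
      on \<open>x\<close>.\<close>
    define S where "S = (\<lambda>n. restrict (\<lambda>g. residual g (axis i n)) ?R)"
    have "range S \<subseteq> PiE ?R (\<lambda>_. ?R)"
      by (auto simp: S_def residual_residual[OF mono])
    then have "finite (range S)"
      by (rule finite_subset) (simp add: finite_PiE fin)
    then have "\<not> inj S"
      using finite_imageD infinite_UNIV_nat by blast
    then obtain m n where "S m = S n" "m \<noteq> n"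
      by (auto simp: inj_on_def)
    then obtain m n where S: "S m = S n" and mn: "m < n"
      by (metis nat_neq_iff)
    have "residual f (x + axis i n) = residual f (x + axis i m)" for x
      using fun_cong[OF S, of "residual f x"] by (simp add: S_def residual_residual[OF mono])
    with mn show ?thesis
      by (intro exI[of _ m] exI[of _ "n - m"]) simp
  qed
  then obtain r l :: "'a \<Rightarrow> nat" where l: "\<And>i. l i \<ge> 1"
    and rl: "\<And>i x. residual f (x + axis i (r i + l i)) = residual f (x + axis i (r i))"
    by metis
  have shift: "residual f (x + axis i (l i)) = residual f x" if "x $ i \<ge> r i" for i x
  proof -
    define y where "y = x - axis i (r i)"
    have "x = y + axis i (r i)" "x + axis i (l i) = y + axis i (r i + l i)"
      using that by (auto simp: y_def vec_eq_iff axis_def)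
    then show ?thesis
      by (simp add: rl)
  qed
  define c where "c = (\<lambda>i. residual f (axis i (r i)) (axis i (l i)))"
  have step: "f (x + axis i (l i)) = f x + c i" if "x $ i \<ge> r i" for i x
  proof -
    have "axis i (r i) \<le> x"
      using that by (simp add: less_eq_vec_def axis_def)
    then obtain z where x: "x = axis i (r i) + z"
      by (rule nat_vec_le_addD)
    let ?a = "axis i (r i) :: nat ^ 'a"
    \<comment> \<open>The period does not change the residual at \<open>?a\<close>, so adding
      \<open>z\<close> contributes equally with or without it; the increment at \<open>x\<close> is
      therefore the one at \<open>?a\<close>.\<close>
    have shift_a: "residual f (?a + axis i (l i)) = residual f ?a"
      by (rule shift) (simp add: axis_def)
    have "f (x + axis i (l i)) = f (?a + axis i (l i) + z)"
      by (simp add: x ac_simps)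
    also have "\<dots> = f (?a + axis i (l i)) + residual f ?a z"
      unfolding residual_add[OF mono, of "?a + axis i (l i)"] shift_a ..
    also have "\<dots> = f ?a + c i + residual f ?a z"
      unfolding residual_add[OF mono, of ?a] c_def ..
    also have "\<dots> = f x + c i"
      unfolding x residual_add[OF mono, of ?a] by (simp add: ac_simps)
    finally show ?thesis .
  qed
  \<comment> \<open>The slopes are chosen so that one period in direction \<open>i\<close> raises
    \<open>M\<close> by exactly \<open>c i\<close>.\<close>
  define M :: "rat ^ 'a \<Rightarrow> rat ^ 'b" where
    "M = (\<lambda>x. \<Sum>i\<in>UNIV. (x $ i / of_nat (l i)) *s rat_vec (c i))"
  have lin: "Vector_Spaces.linear (*s) (*s) M"
    by unfold_locales
      (simp_all add: M_def vec_eq_iff sum.distrib[symmetric] sum_distrib_left add_divide_distrib algebra_simps)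
  have M_axis: "M (rat_vec (axis i (l i))) = rat_vec (c i)" for i
  proof -
    have "M (rat_vec (axis i (l i))) = (\<Sum>j\<in>UNIV. if j = i then rat_vec (c i) else 0)"
      unfolding M_def using l[of i]
      by (intro sum.cong) (auto simp: rat_vec_def axis_def vec_eq_iff)
    then show ?thesis by simp
  qed
  define L where "L = (\<lambda>x. M (rat_vec x))"
  have L: "linear_on_nat L"
    using lin by (auto simp: linear_on_nat_def L_def)
  \<comment> \<open>Beyond the threshold, one period adds \<open>c i\<close> to both
    \<open>f\<close> and \<open>L\<close>, so their difference is unchanged.\<close>
  have "eventually_periodic (\<lambda>x. rat_vec (f x) - L x)"
    unfolding eventually_periodic_def
  proof (intro exI conjI allI impI)
    fix i and x :: "nat ^ 'a"
    assume "int (x $ i) \<ge> int (r i)"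
    then have "f (x + axis i (l i)) = f x + c i"
      by (intro step) simp
    moreover have "L (axis i (l i)) = rat_vec (c i)"
      by (simp add: L_def M_axis)
    ultimately show "rat_vec (f x) - L x = rat_vec (f (x + axis i (l i))) - L (x + axis i (l i))"
      by (simp add: linear_on_nat_add[OF L] rat_vec_add)
  qed (rule l)
  with L show thesis
    by (rule that) simp
qed

theorem theorem2p4:
  fixes f :: "nat ^ 'k \<Rightarrow> nat ^ 'l"
  shows "computable_by_finite_abelian_processor f \<longleftrightarrow>
    f 0 = 0 \<and> mono f \<and>
    (\<exists>(L :: nat ^ 'k \<Rightarrow> rat ^ 'l) (P :: nat ^ 'k \<Rightarrow> rat ^ 'l).
       linear_on_nat L \<and> eventually_periodic P \<and> (\<forall>x. rat_vec (f x) = L x + P x))"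
  by (meson computable_imp_finite_residuals finite_residuals_imp_computable
      finite_residuals_imp_linear_plus_periodic linear_plus_periodic_imp_finite_residuals)

end
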